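(* Let $\{e_i\}_{i=1}^n$ be the standard orthonormal basis of $\mathbb{R}^n$ and let $S$ be an $s$-dimensional subspace of $\mathbb{R}^n$. If \[\|y\|_1\le\sqrt s\,\|y\|_2\quad\text{for all } y\in S,\] then there is a subset $I\subset[n]$ with $|I|=s$ and $S=\operatorname{span}\{e_i\}_{i\in I}$.
   Context: $[n]=\{1,2,\ldots,n\}$. For $y=(b_1,\ldots,b_n)\in\mathbb{R}^n$ (coordinates with respect to the basis $\{e_i\}_{i=1}^n$), $\|y\|_1=\sum_{i=1}^n|b_i|$ and $\|y\|_2=\left(\sum_{i=1}^n b_i^2\right)^{1/2}$. *)

theory Defs
  imports "HOL-Analysis.Analysis"
begin

text \<open>The library norm on \<^typ>\<open>real ^ 'n\<close> is the Euclidean norm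
  (see \<open>norm_vec_def\<close> and \<open>L2_set_def\<close>); the 1-norm has no library counterpart.\<close>

definition l1_norm :: "real ^ 'n \<Rightarrow> real" where
  "l1_norm y = (\<Sum>i\<in>UNIV. \<bar>y $ i\<bar>)"

end

theory Submission
  imports Defs
begin

text \<open>Let \<open>P\<close> be the orthogonal projection onto \<open>S\<close>. For a sign vector \<open>\<epsilon>\<close> the
  hypothesis at \<open>y = P \<epsilon>\<close> gives \<open>\<parallel>P \<epsilon>\<parallel>\<^sup>2 = \<epsilon> \<bullet> P \<epsilon> \<le> \<parallel>P \<epsilon>\<parallel>\<^sub>1 \<le> sqrt s \<parallel>P \<epsilon>\<parallel>\<close>, so
  \<open>\<parallel>P \<epsilon>\<parallel>\<^sup>2 \<le> s\<close>. The average of \<open>\<parallel>P \<epsilon>\<parallel>\<^sup>2\<close> over all signs is the trace \<open>s\<close> of \<open>P\<close>, so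
  equality holds for every \<open>\<epsilon>\<close>. Flipping the sign of one coordinate \<open>i\<close> then yields
  \<open>P e\<^sub>i \<bullet> \<epsilon> = \<epsilon>\<^sub>i (P e\<^sub>i)\<^sub>i\<close> for all \<open>\<epsilon>\<close>, which forces \<open>P e\<^sub>i\<close> to be a multiple of \<open>e\<^sub>i\<close>.
  Hence each \<open>e\<^sub>i\<close> is either in \<open>S\<close> or orthogonal to \<open>S\<close>.\<close>

text \<open>Indexing by the set of positive coordinates makes the average over all signs a sum over
  the finite type \<open>'n set\<close>, and a sign flip a change of membership.\<close>

definition sign_vec :: "'n set \<Rightarrow> real ^ 'n" where
  "sign_vec A = (\<chi> i. if i \<in> A then 1 else - 1)"

lemma sign_vec_nth [simp]: "sign_vec A $ i = (if i \<in> A then 1 else - 1)"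
  by (simp add: sign_vec_def)

lemma sum_sign_vec_mult:
  "(\<Sum>A\<in>UNIV. sign_vec A $ i * sign_vec A $ j)
    = (if i = j then real (card (UNIV :: 'n set set)) else 0)" for i j :: "'n::finite"
proof (cases "i = j")
  case False
  \<comment> \<open>Toggling the membership of \<open>i\<close> in \<open>A\<close> is an involution
    that negates each summand when \<open>i\<close> and \<open>j\<close> differ.\<close>
  have "(\<Sum>A\<in>UNIV. sign_vec A $ i * sign_vec A $ j)
      = (\<Sum>A\<in>UNIV. - (sign_vec A $ i * sign_vec A $ j))"
    by (rule sum.reindex_bij_witness
        [where i = "\<lambda>A. sym_diff A {i}" and j = "\<lambda>A. sym_diff A {i}"]) (use False in auto)
  then show ?thesis
    using False by (simp add: sum_negf)
next
  case True
  have "sign_vec A $ j * sign_vec A $ j = 1" for A :: "'n set"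
    by simp
  then show ?thesis
    using True by simp
qed

lemma linear_axis_expansion:
  fixes f :: "real ^ 'n \<Rightarrow> 'a::real_vector"
  assumes "linear f"
  shows "f x = (\<Sum>i\<in>UNIV. x $ i *\<^sub>R f (axis i 1))"
proof -
  have "f x = f (\<Sum>i\<in>UNIV. x $ i *\<^sub>R axis i 1)"
    using basis_expansion[of x] by (simp add: scalar_mult_eq_scaleR)
  then show ?thesis
    by (simp add: linear_sum[OF assms] linear_cmul[OF assms])
qed

text \<open>Distinct sign coordinates are uncorrelated, so only the diagonal entries of
  \<open>f\<close> survive the averaging, and they add up to its trace.\<close>

lemma sum_sign_vec_quadratic:
  fixes f :: "real ^ 'n \<Rightarrow> real ^ 'n"
  assumes "linear f"
  shows "(\<Sum>A\<in>UNIV. sign_vec A \<bullet> f (sign_vec A))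
    = real (card (UNIV :: 'n set set)) * (\<Sum>i\<in>UNIV. f (axis i 1) $ i)"
proof -
  have "sign_vec A \<bullet> f (sign_vec A)
      = (\<Sum>i\<in>UNIV. \<Sum>j\<in>UNIV. (sign_vec A $ i * sign_vec A $ j) * f (axis j 1) $ i)"
    for A :: "'n set"
    by (subst linear_axis_expansion[OF assms])
      (simp add: inner_vec_def sum_distrib_left mult.assoc del: sign_vec_nth)
  then have "(\<Sum>A\<in>UNIV. sign_vec A \<bullet> f (sign_vec A))
      = (\<Sum>A\<in>UNIV. \<Sum>i\<in>UNIV. \<Sum>j\<in>UNIV. (sign_vec A $ i * sign_vec A $ j) * f (axis j 1) $ i)"
    by (simp only:)
  also have "\<dots> = (\<Sum>i\<in>UNIV. \<Sum>j\<in>UNIV. \<Sum>A\<in>UNIV. (sign_vec A $ i * sign_vec A $ j) * f (axis j 1) $ i)"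
    by (subst sum.swap, rule sum.cong[OF refl], rule sum.swap)
  also have "\<dots> = (\<Sum>i\<in>UNIV. \<Sum>j\<in>UNIV.
      (\<Sum>A\<in>UNIV. sign_vec A $ i * sign_vec A $ j) * f (axis j 1) $ i)"
    by (simp only: sum_distrib_right)
  also have "\<dots> = (\<Sum>i\<in>UNIV. \<Sum>j\<in>UNIV.
      if i = j then real (card (UNIV :: 'n set set)) * f (axis j 1) $ i else 0)"
    unfolding sum_sign_vec_mult by (intro sum.cong refl) simp
  also have "\<dots> = real (card (UNIV :: 'n set set)) * (\<Sum>i\<in>UNIV. f (axis i 1) $ i)"
    by (simp add: sum_distrib_left)
  finally show ?thesis .
qed

text \<open>Expansion in an orthonormal basis \<open>B\<close> of \<open>S\<close>: the trace is the
  sum of \<open>b \<bullet> b\<close> over \<open>B\<close>, hence \<open>card B\<close>.\<close>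

lemma orthogonal_projection_exists:
  fixes S :: "(real ^ 'n) set"
  assumes "subspace S"
  shows "\<exists>P :: real ^ 'n \<Rightarrow> real ^ 'n. linear P \<and> (\<forall>x. P x \<in> S) \<and>
    (\<forall>x. \<forall>y\<in>S. y \<bullet> P x = y \<bullet> x) \<and> (\<Sum>i\<in>UNIV. P (axis i 1) $ i) = real (dim S)"
proof -
  obtain B where B: "B \<subseteq> S" "pairwise orthogonal B" "\<And>b. b \<in> B \<Longrightarrow> norm b = 1"
    "independent B" "card B = dim S" "span B = S"
    using orthonormal_basis_subspace[OF assms] by blast
  define P where "P x = (\<Sum>b\<in>B. (b \<bullet> x) *\<^sub>R b)" for x
  have unit: "b \<bullet> b = 1" if "b \<in> B" for b
    using B(3)[OF that] by (simp add: norm_eq_1)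
  show ?thesis
  proof (intro exI[of _ P] conjI allI ballI)
    show "linear P"
      unfolding P_def
      by (intro linearI)
        (simp_all add: inner_add_right scaleR_add_left sum.distrib scaleR_sum_right)
    show "P x \<in> S" for x
      unfolding P_def using B(1) by (intro subspace_sum[OF assms] subspace_scale[OF assms]) auto
    show "y \<bullet> P x = y \<bullet> x" if "y \<in> S" for x y
    proof -
      have "orthogonal y (x - (\<Sum>b\<in>B. (b \<bullet> x / (b \<bullet> b)) *\<^sub>R b))"
        using Gram_Schmidt_step[OF B(2)] that B(6) by blast
      moreover have "(\<Sum>b\<in>B. (b \<bullet> x / (b \<bullet> b)) *\<^sub>R b) = P x"
        unfolding P_def by (intro sum.cong) (simp_all add: unit)
      ultimately show ?thesis
        by (simp add: orthogonal_def inner_diff_right)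
    qed
    have "(\<Sum>i\<in>UNIV. P (axis i 1) $ i) = (\<Sum>i\<in>UNIV. \<Sum>b\<in>B. b $ i * b $ i)"
      by (simp add: P_def inner_axis)
    also have "\<dots> = (\<Sum>b\<in>B. b \<bullet> b)"
      by (subst sum.swap) (simp add: inner_vec_def)
    also have "\<dots> = real (dim S)"
      by (simp add: unit B(5))
    finally show "(\<Sum>i\<in>UNIV. P (axis i 1) $ i) = real (dim S)" .
  qed
qed

lemma inner_sign_vec_le_l1_norm: "sign_vec A \<bullet> y \<le> l1_norm y"
  unfolding inner_vec_def l1_norm_def by (intro sum_mono) auto

lemma inner_sign_vec_eq_l1_norm: "y \<bullet> sign_vec {i. 0 \<le> y $ i} = l1_norm y"
  unfolding inner_vec_def l1_norm_def by (intro sum.cong) auto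

text \<open>The deficits \<open>c - f a\<close> are nonnegative and sum to zero.\<close>

lemma sum_eq_card_imp_eq:
  fixes f :: "'a \<Rightarrow> real"
  assumes "finite A" "\<And>a. a \<in> A \<Longrightarrow> f a \<le> c" "sum f A = real (card A) * c" "a \<in> A"
  shows "f a = c"
proof -
  have "(\<Sum>a\<in>A. c - f a) = 0"
    using assms(3) by (simp add: sum_subtractf)
  then show ?thesis
    using sum_nonneg_eq_0_iff[of A "\<lambda>a. c - f a"] assms by auto
qed

lemma card_eq_dim_span_axis:
  "card I = dim (span ((\<lambda>i. axis i 1 :: real ^ 'n) ` I))"
proof -
  have "independent ((\<lambda>i. axis i 1 :: real ^ 'n) ` I)"
    by (rule pairwise_orthogonal_independent)
      (auto simp: pairwise_def orthogonal_def inner_axis_axis axis_eq_axis)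
  moreover have "inj_on (\<lambda>i. axis i 1 :: real ^ 'n) I"
    by (auto simp: inj_on_def axis_eq_axis)
  ultimately show ?thesis
    by (simp add: dim_eq_card_independent card_image)
qed

theorem theorem2p5:
  fixes S :: "(real ^ 'n) set" and s :: nat
  assumes "subspace S" and "dim S = s"
    and "\<And>y. y \<in> S \<Longrightarrow> l1_norm y \<le> sqrt (real s) * norm y"
  shows "\<exists>I :: 'n set. card I = s \<and> S = span ((\<lambda>i. axis i 1) ` I)"
proof -
  obtain P :: "real ^ 'n \<Rightarrow> real ^ 'n" where P: "linear P" "\<And>x. P x \<in> S" "\<And>x y. y \<in> S \<Longrightarrow> y \<bullet> P x = y \<bullet> x"
    and trace: "(\<Sum>i\<in>UNIV. P (axis i 1) $ i) = real s"
    using orthogonal_projection_exists[OF assms(1)] unfolding assms(2) by blast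
  have sq: "x \<bullet> P x = P x \<bullet> P x" for x
    using P(3)[OF P(2)] by (metis inner_commute)
  have le: "sign_vec A \<bullet> P (sign_vec A) \<le> real s" for A :: "'n set"
  proof -
    let ?N = "norm (P (sign_vec A))"
    have "?N * ?N \<le> sqrt (real s) * ?N"
      using inner_sign_vec_le_l1_norm[of A "P (sign_vec A)"] assms(3)[OF P(2), of "sign_vec A"]
      by (simp add: sq norm_eq_sqrt_inner)
    then have "?N \<le> sqrt (real s)"
      by (cases "?N = 0") (auto simp: mult_le_cancel_right)
    then have "?N\<^sup>2 \<le> real s"
      by (metis norm_ge_zero of_nat_0_le_iff power_mono real_sqrt_pow2)
    then show ?thesis
      by (simp add: sq power2_norm_eq_inner)
  qed
  have eq: "sign_vec A \<bullet> P (sign_vec A) = real s" for A :: "'n set"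
    by (rule sum_eq_card_imp_eq[OF finite_class.finite_UNIV])
      (simp_all add: le sum_sign_vec_quadratic[OF P(1)] trace)
  have off: "P (axis i 1) $ j = 0" if "j \<noteq> i" for i j :: 'n
  proof -
    let ?e = "axis i 1 :: real ^ 'n"
    have diag: "?e \<bullet> P ?e = P ?e $ i" "P ?e \<bullet> P ?e = P ?e $ i"
      using sq[of ?e] by (simp_all add: inner_axis')
    \<comment> \<open>The signs are matched to the entries of \<open>P ?e\<close>, so that its inner
      product with \<open>?x\<close> is its full 1-norm.\<close>
    define A where "A = {j. 0 \<le> P ?e $ j}"
    let ?x = "sign_vec A"
    \<comment> \<open>By \<open>diag\<close>, entry \<open>i\<close> is a squared norm, hence
      nonnegative; so flipping sign \<open>i\<close> means removing \<open>i\<close> from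
      \<open>A\<close>.\<close>
    have i: "?x $ i = 1"
      using diag(2) inner_ge_zero[of "P ?e"] by (simp add: A_def)
    have flip: "sign_vec (A - {i}) = ?x - 2 *\<^sub>R ?e"
      using i by (auto simp: vec_eq_iff axis_def split: if_splits)
    \<comment> \<open>Self-adjointness: \<open>P u \<bullet> v = P u \<bullet> P v\<close>, which is
      symmetric in \<open>u\<close> and \<open>v\<close>.\<close>
    have sym: "?e \<bullet> P ?x = P ?e \<bullet> ?x" "?x \<bullet> P ?e = P ?e \<bullet> ?x"
      using P(3)[OF P(2)] by (metis inner_commute)+
    have "(?x - 2 *\<^sub>R ?e) \<bullet> P (?x - 2 *\<^sub>R ?e) = ?x \<bullet> P ?x"
      using eq[of A] eq[of "A - {i}"] flip by simp
    \<comment> \<open>Expanding the left side changes \<open>?x \<bullet> P ?x\<close> by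
      \<open>- 4 * (P ?e \<bullet> ?x) + 4 * P ?e $ i\<close>, which must vanish.\<close>
    then have "P ?e \<bullet> ?x = P ?e $ i"
      by (simp add: linear_diff[OF P(1)] linear_cmul[OF P(1)] inner_diff_left inner_diff_right
          sym diag)
    then have "l1_norm (P ?e) = P ?e $ i"
      using inner_sign_vec_eq_l1_norm[of "P ?e"] by (simp add: A_def)
    moreover have "l1_norm (P ?e) = \<bar>P ?e $ i\<bar> + (\<Sum>j\<in>UNIV - {i}. \<bar>P ?e $ j\<bar>)"
      unfolding l1_norm_def by (rule sum.remove) auto
    ultimately have "(\<Sum>j\<in>UNIV - {i}. \<bar>P ?e $ j\<bar>) \<le> 0"
      by linarith
    then have "(\<Sum>j\<in>UNIV - {i}. \<bar>P ?e $ j\<bar>) = 0"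
      by (simp add: antisym sum_nonneg)
    then show ?thesis
      using that by (simp add: sum_nonneg_eq_0_iff)
  qed
  have dich: "y $ i = 0" if "axis i 1 \<notin> S" "y \<in> S" for i y
  proof -
    let ?c = "P (axis i 1) $ i"
    have scale: "P (axis i 1) = ?c *\<^sub>R axis i 1"
      using off by (auto simp: vec_eq_iff axis_def)
    \<comment> \<open>\<open>axis i 1\<close> is an eigenvector of \<open>P\<close> with eigenvalue
      \<open>?c\<close>; a nonzero eigenvalue would put it in the range of \<open>P\<close>, inside
      \<open>S\<close>.\<close>
    have "?c = 0"
    proof (rule ccontr)
      assume "?c \<noteq> 0"
      then have "axis i 1 = (1 / ?c) *\<^sub>R P (axis i 1)"
        by (subst scale) simp
      then show False
        using subspace_scale[OF assms(1) P(2)] that(1) by metis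
    qed
    then have "P (axis i 1) = 0"
      using scale by simp
    \<comment> \<open>For \<open>y\<close> in \<open>S\<close>, \<open>y $ i\<close> is the inner
      product of \<open>y\<close> with \<open>axis i 1\<close>, hence with its projection, which is
      zero.\<close>
    then show ?thesis
      using P(3)[OF that(2), of "axis i 1"] by (simp add: inner_axis)
  qed
  define I where "I = {i. axis i (1::real) \<in> S}"
  have "S = span ((\<lambda>i. axis i 1) ` I)"
  proof
    show "span ((\<lambda>i. axis i 1) ` I) \<subseteq> S"
      by (rule span_minimal) (auto simp: I_def assms(1))
    show "S \<subseteq> span ((\<lambda>i. axis i 1) ` I)"
    proof
      fix y assume "y \<in> S"
      have "y $ i *\<^sub>R axis i (1::real) \<in> span ((\<lambda>i. axis i 1) ` I)" for i
      proof (cases "i \<in> I")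
        case True
        then show ?thesis by (intro span_scale span_base) auto
      next
        case False
        then show ?thesis using dich \<open>y \<in> S\<close> by (simp add: I_def span_zero)
      qed
      then have "(\<Sum>i\<in>UNIV. y $ i *\<^sub>R axis i (1::real)) \<in> span ((\<lambda>i. axis i 1) ` I)"
        by (intro span_sum)
      then show "y \<in> span ((\<lambda>i. axis i 1) ` I)"
        using linear_axis_expansion[OF linear_ident, of y] by simp
    qed
  qed
  then show ?thesis
    using card_eq_dim_span_axis[of I] assms(2) by metis
qed

end
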